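(* Let $T$ be a finite rooted ordered tree with root $r$ and let $v_1,v_2\in T\setminus\{r\}$ with $v_1<v_2$ in depth-first traversal order of $T$. Then $$\mathsf{pda}(v_1,v_2)=\max_{<}\{x\mid v_1\le x\le v_2,\ \mathrm{depth}_T(x)=\mathrm{depth}_T(v_1,v_2)\},$$ i.e. the primal-dual ancestor of $v_1,v_2$ is the last node, in depth-first order of $T$, among those nodes between $v_1$ and $v_2$ (inclusive) whose depth in $T$ is minimal.
   Context: Depth-first traversal order $<$ on $T$ is preorder. $\mathrm{depth}_T(x)$ is the distance from $r$ to $x$ in $T$, and $\mathrm{depth}_T(v_1,v_2):=\min\{\mathrm{depth}_T(y)\mid v_1\le y\le v_2\}$. $T[v]$ is the subtree of $v$ in $T$ (v and its descendants), and $T^*[v]$ the subtree of $v$ in the dual tree $T^*$. The dual $T^*$ has the same vertex set and root $r$; with $rmc_T(u)$ the rightmost child and $ils_T(u)$ the immediate left sibling of $u$ in $T$: (1a) $r$ has no parent in $T^*$; (1b) if $v=rmc_T(r)$ then $v$ is the rightmost child of $r$ in $T^*$; (2) if $v=rmc_T(u)$ with $u\ne r$, then $v$ is the immediate left sibling of $u$ in $T^*$; (3) if $v=ils_T(u)$, then $v$ is the rightmost child of $u$ in $T^*$. For $v_1\le v_2$ non-root, there is a unique $v\in T\setminus\{r\}$ with $v_1\in T^*[v]$ and $v_2\in T[v]$; it is called the primal-dual ancestor $\mathsf{pda}(v_1,v_2)$. *)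

theory Defs
  imports Main
begin

text \<open>The vertices of an ordered tree are its labels, which therefore have to be pairwise distinct
  (\<open>ordered_tree\<close> below). Children are listed from left to right.\<close>

datatype (vertices: 'a) otree = Node (tree_root: 'a) (branches: "'a otree list")

fun preorder :: "'a otree \<Rightarrow> 'a list" where
  "preorder (Node x ts) = x # concat (map preorder ts)"

definition ordered_tree :: "'a otree \<Rightarrow> bool" where
  "ordered_tree T \<longleftrightarrow> distinct (preorder T)"

definition preorder_less :: "'a otree \<Rightarrow> 'a \<Rightarrow> 'a \<Rightarrow> bool" where
  "preorder_less T x y \<longleftrightarrow>
     (\<exists>i j. i < j \<and> j < length (preorder T) \<and> preorder T ! i = x \<and> preorder T ! j = y)"

definition preorder_le :: "'a otree \<Rightarrow> 'a \<Rightarrow> 'a \<Rightarrow> bool" where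
  "preorder_le T x y \<longleftrightarrow>
     (\<exists>i j. i \<le> j \<and> j < length (preorder T) \<and> preorder T ! i = x \<and> preorder T ! j = y)"

definition preorder_Max :: "'a otree \<Rightarrow> 'a set \<Rightarrow> 'a" where
  "preorder_Max T X = (THE m. m \<in> X \<and> (\<forall>x\<in>X. preorder_le T x m))"

fun subtrees :: "'a otree \<Rightarrow> 'a otree set" where
  "subtrees (Node x ts) = insert (Node x ts) (\<Union>t\<in>set ts. subtrees t)"

definition child_rel :: "'a otree \<Rightarrow> ('a \<times> 'a) set" where
  "child_rel T = {(u, v). \<exists>ts. Node u ts \<in> subtrees T \<and> v \<in> tree_root ` set ts}"

text \<open>\<open>is_rmc T u v\<close>: \<open>v\<close> is the rightmost child of \<open>u\<close>.
  \<open>is_ils T u v\<close>: \<open>v\<close> is the immediate left sibling of \<open>u\<close>.\<close>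

definition is_rmc :: "'a otree \<Rightarrow> 'a \<Rightarrow> 'a \<Rightarrow> bool" where
  "is_rmc T u v \<longleftrightarrow> (\<exists>ts t. Node u (ts @ [t]) \<in> subtrees T \<and> tree_root t = v)"

definition is_ils :: "'a otree \<Rightarrow> 'a \<Rightarrow> 'a \<Rightarrow> bool" where
  "is_ils T u v \<longleftrightarrow>
     (\<exists>w ts s t ts'. Node w (ts @ s # t # ts') \<in> subtrees T \<and> tree_root s = v \<and> tree_root t = u)"

definition subtree_verts :: "'a otree \<Rightarrow> 'a \<Rightarrow> 'a set" where
  "subtree_verts T v = (child_rel T)\<^sup>* `` {v}"

definition tree_dist :: "'a otree \<Rightarrow> 'a \<Rightarrow> 'a \<Rightarrow> nat" where
  "tree_dist T x y = (LEAST n. (x, y) \<in> (child_rel T \<union> (child_rel T)\<inverse>) ^^ n)"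

definition depth :: "'a otree \<Rightarrow> 'a \<Rightarrow> nat" where
  "depth T x = tree_dist T (tree_root T) x"

definition depth_between :: "'a otree \<Rightarrow> 'a \<Rightarrow> 'a \<Rightarrow> nat" where
  "depth_between T v1 v2 = Min (depth T ` {y. preorder_le T v1 y \<and> preorder_le T y v2})"

text \<open>The last three clauses determine \<open>S\<close> uniquely: every vertex \<open>v\<close> other than the root is, in the
  ordered tree \<open>T\<close>, either the rightmost child of exactly one vertex or the immediate left sibling of
  exactly one vertex, so each such \<open>v\<close> is placed in \<open>S\<close> by exactly one of them.\<close>

definition is_dual :: "'a otree \<Rightarrow> 'a otree \<Rightarrow> bool" where
  "is_dual T S \<longleftrightarrow>
     ordered_tree S \<and> vertices S = vertices T \<and> tree_root S = tree_root T \<and>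
     (\<nexists>u. (u, tree_root T) \<in> child_rel S) \<and>
     (\<forall>v. is_rmc T (tree_root T) v \<longrightarrow> is_rmc S (tree_root T) v) \<and>
     (\<forall>u v. u \<noteq> tree_root T \<and> is_rmc T u v \<longrightarrow> is_ils S u v) \<and>
     (\<forall>u v. is_ils T u v \<longrightarrow> is_rmc S u v)"

definition dual_tree :: "'a otree \<Rightarrow> 'a otree" where
  "dual_tree T = (THE S. is_dual T S)"

definition pda :: "'a otree \<Rightarrow> 'a \<Rightarrow> 'a \<Rightarrow> 'a" where
  "pda T v1 v2 =
     (THE v. v \<in> vertices T - {tree_root T} \<and>
             v1 \<in> subtree_verts (dual_tree T) v \<and> v2 \<in> subtree_verts T v)"

end

theory Submission imports Defs begin

text \<open>In the dual tree, the descendants of a non-root vertex \<open>v\<close> are \<open>v\<close> itself and all vertices of the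
  subtrees of \<open>T\<close> rooted at left siblings of \<open>v\<close>. So \<open>v\<close> is the primal-dual ancestor of \<open>v1\<close> and \<open>v2\<close> iff
  \<open>v2\<close> lies below \<open>v\<close> and \<open>v1\<close> is \<open>v\<close> or lies below a left sibling of \<open>v\<close>. Then the preorder interval
  from \<open>v1\<close> to \<open>v2\<close> consists of vertices at least as deep as \<open>v\<close>, followed by \<open>v\<close>, followed by proper
  descendants of \<open>v\<close>; so \<open>v\<close> is its last vertex of minimal depth.\<close>

section \<open>Positions in an ordered tree\<close>

lemma set_preorder: "set (preorder T) = vertices T"
  by (induction T) auto

lemma distinct_concat_mapD:
  assumes "distinct (concat (map f xs))" "x \<in> set xs" "y \<in> set xs" "a \<in> set (f x)" "a \<in> set (f y)"
  shows "x = y"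
  using assms by (induction xs) auto

lemma distinct_concat_map_elem:
  "distinct (concat (map f xs)) \<Longrightarrow> x \<in> set xs \<Longrightarrow> distinct (f x)"
  by (induction xs) auto

lemma ordered_tree_Node:
  "ordered_tree (Node r ts) \<longleftrightarrow> r \<notin> (\<Union>t\<in>set ts. vertices t) \<and> distinct (concat (map preorder ts))"
  by (simp add: ordered_tree_def set_preorder)

lemma ordered_tree_branch:
  "ordered_tree (Node r ts) \<Longrightarrow> t \<in> set ts \<Longrightarrow> ordered_tree t"
  by (auto simp: ordered_tree_def dest: distinct_concat_map_elem)

lemma branches_disjoint:
  assumes "ordered_tree (Node r ts)" "s \<in> set ts" "t \<in> set ts" "a \<in> vertices s" "a \<in> vertices t"
  shows "s = t"
  using assms distinct_concat_mapD[of preorder ts s t a]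
  by (auto simp: ordered_tree_Node set_preorder)

lemma tree_root_in_vertices [simp]: "tree_root t \<in> vertices t"
  by (cases t) auto

lemma self_in_subtrees [simp]: "t \<in> subtrees t"
  by (cases t) auto

lemma subtrees_trans: "s \<in> subtrees t \<Longrightarrow> t \<in> subtrees T \<Longrightarrow> s \<in> subtrees T"
  by (induction T) auto

lemma branch_subtree: "Node w ts \<in> subtrees T \<Longrightarrow> t \<in> set ts \<Longrightarrow> t \<in> subtrees T"
  by (rule subtrees_trans[of _ "Node w ts"]) (auto intro!: bexI[of _ t])

lemma vertices_subtree: "s \<in> subtrees T \<Longrightarrow> vertices s \<subseteq> vertices T"
  by (induction T) auto

lemma vertex_subtree: "x \<in> vertices T \<Longrightarrow> \<exists>ts. Node x ts \<in> subtrees T"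
proof (induction T)
  case (Node y ts)
  then show ?case by (cases "x = y") (auto, blast)
qed

text \<open>Branches have disjoint vertex sets, so a label cannot occur in two of them, nor both at
  the root and below it. A vertex thus stands for one subtree, and any two decompositions found at
  it may be identified.\<close>

lemma subtree_unique:
  assumes "ordered_tree T" "s \<in> subtrees T" "t \<in> subtrees T" "tree_root s = tree_root t"
  shows "s = t"
  using assms
proof (induction T)
  case (Node r ts)
  have *: "t' = Node r ts" if t': "t' \<in> subtrees (Node r ts)" "tree_root t' = r" for t'
  proof (rule ccontr)
    assume "t' \<noteq> Node r ts"
    then obtain b where "b \<in> set ts" "t' \<in> subtrees b" using t'(1) by auto
    then have "r \<in> vertices b"
      using vertices_subtree[of t' b] t'(2) tree_root_in_vertices[of t'] by blast
    then show False using \<open>b \<in> set ts\<close> Node.prems(1) by (auto simp: ordered_tree_Node)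
  qed
  show ?case
  proof (cases "tree_root s = r")
    case True
    then show ?thesis using *[of s] *[of t] Node.prems by simp
  next
    case False
    then obtain b c where b: "b \<in> set ts" "s \<in> subtrees b" and c: "c \<in> set ts" "t \<in> subtrees c"
      using Node.prems by auto
    have "tree_root s \<in> vertices b" using vertices_subtree[OF b(2)] by auto
    moreover have "tree_root s \<in> vertices c"
      using vertices_subtree[OF c(2)] Node.prems(4) by auto
    ultimately have "b = c" by (rule branches_disjoint[OF Node.prems(1) b(1) c(1)])
    then show ?thesis
      using Node.IH[OF b(1) ordered_tree_branch[OF Node.prems(1) b(1)] b(2)] c Node.prems(4) by simp
  qed
qed

text \<open>A branch labelled like the root would be all of \<open>T\<close> by
  \<open>subtree_unique\<close>. Then \<open>T\<close> would be a proper branch of one of its own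
  subtrees, which the sizes rule out.\<close>

lemma branch_not_root:
  assumes "ordered_tree T" "Node w (as @ s # bs) \<in> subtrees T"
  shows "tree_root s \<noteq> tree_root T"
proof
  assume eq: "tree_root s = tree_root T"
  have "s \<in> subtrees T"
    by (rule branch_subtree[OF assms(2)]) simp
  then have "s = T" using subtree_unique[OF assms(1)] eq by auto
  have "size (Node w (as @ T # bs)) \<le> size T"
  proof -
    have "size t \<le> size T" if "t \<in> subtrees T" for t :: "'a otree" and T
      using that
    proof (induction T)
      case (Node x ts)
      have "size t' \<le> size_list size ts" if "t' \<in> set ts" for t'
        using that by (induction ts) auto
      then show ?case using Node by (auto, fastforce)
    qed
    then show ?thesis using assms(2) \<open>s = T\<close> by blast
  qed
  then show False by (simp add: size_list_append)
qed

text \<open>If the prefixes \<open>as\<close> and \<open>cs\<close> had different lengths, the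
  common root label would occur in two different entries of the list.\<close>

lemma distinct_root_position:
  assumes "distinct (concat (map preorder (as @ s # bs)))" "as @ s # bs = cs @ t # ds"
    and "tree_root s = tree_root t"
  shows "as = cs \<and> s = t \<and> bs = ds"
  using assms
proof (induction as arbitrary: cs)
  case Nil
  show ?case
  proof (cases cs)
    case (Cons c cs')
    then have "tree_root t \<in> vertices s" "t \<in> set bs"
      using Nil tree_root_in_vertices[of s] by auto
    moreover from this have "tree_root t \<in> (\<Union>t\<in>set bs. vertices t)" by (auto intro!: bexI[of _ t])
    ultimately show ?thesis using Nil(1) by (auto simp: set_preorder)
  qed (use Nil in auto)
next
  case (Cons a as)
  note IH = Cons.IH and prems = Cons.prems
  show ?case
  proof (cases cs)
    case Nil
    then have "tree_root t \<in> vertices a" "tree_root t \<in> vertices s"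
      using Cons.prems tree_root_in_vertices[of s] by auto
    then show ?thesis using Cons.prems(1) by (auto simp: set_preorder)
  next
    case (Cons c cs')
    have "distinct (concat (map preorder (as @ s # bs)))" using prems(1) by simp
    from IH[OF this _ prems(3), of cs'] show ?thesis using prems(2) Cons by simp
  qed
qed

text \<open>This permits replacing the existential witnesses in \<open>is_rmc\<close> and
  \<open>is_ils\<close> by any known occurrence of the vertex, with its parent and its siblings on
  both sides.\<close>

lemma branch_position_unique:
  assumes "ordered_tree T" "Node w (as @ s # bs) \<in> subtrees T" "Node x (cs @ t # ds) \<in> subtrees T"
    and "tree_root s = tree_root t"
  shows "w = x \<and> as = cs \<and> s = t \<and> bs = ds"
  using assms
proof (induction T)
  case (Node r ts)
  \<comment> \<open>One occurrence at top level and the other strictly inside a branch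
    \<open>b\<close> is impossible: disjointness forces \<open>s = b\<close>, and then the root
    label of \<open>b\<close> reappears below its root.\<close>
  have clash: False if 1: "ts = as @ s # bs" and 2: "b \<in> set ts" "Node x (cs @ t # ds) \<in> subtrees b"
    and 3: "tree_root s = tree_root t" for as bs cs ds x b and s t :: "'a otree"
  proof -
    have "t \<in> subtrees b"
      by (rule branch_subtree[OF 2(2)]) simp
    then have "tree_root t \<in> vertices b" using vertices_subtree tree_root_in_vertices by blast
    moreover have "tree_root t \<in> vertices s" using 3 tree_root_in_vertices by metis
    ultimately have "s = b" using branches_disjoint[OF Node.prems(1)] 1 2(1) by auto
    then show False
      using branch_not_root[OF ordered_tree_branch[OF Node.prems(1) 2(1)] 2(2)] 3 by simp
  qed
  from Node.prems(2) consider (top) "w = r" "ts = as @ s # bs"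
    | (sub) b where "b \<in> set ts" "Node w (as @ s # bs) \<in> subtrees b" by auto
  then show ?case
  proof cases
    case top
    have "\<not> (\<exists>b\<in>set ts. Node x (cs @ t # ds) \<in> subtrees b)"
      using clash[OF top(2) _ _ Node.prems(4)] by blast
    then have "x = r" "ts = cs @ t # ds" using Node.prems(3) by simp_all
    then show ?thesis using top Node.prems(1,4) distinct_root_position[of as s bs cs t ds]
      by (auto simp: ordered_tree_Node)
  next
    case sub
    have "ts \<noteq> cs @ t # ds" using clash[OF _ sub Node.prems(4)[symmetric]] by blast
    then obtain c where c: "c \<in> set ts" "Node x (cs @ t # ds) \<in> subtrees c"
      using Node.prems(3) by auto
    have "s \<in> subtrees b" "t \<in> subtrees c"
      using branch_subtree[OF sub(2)] branch_subtree[OF c(2)] by simp_all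
    then have "tree_root t \<in> vertices b" "tree_root t \<in> vertices c"
      using vertices_subtree tree_root_in_vertices Node.prems(4) by (metis subsetD)+
    then have "b = c" using branches_disjoint[OF Node.prems(1)] sub c by blast
    then show ?thesis
      using Node.IH[OF sub(1) ordered_tree_branch[OF Node.prems(1) sub(1)] sub(2)] c Node.prems(4)
      by blast
  qed
qed

section \<open>Rightmost children and immediate left siblings\<close>

lemma is_rmcI: "Node u (ts @ [t]) \<in> subtrees T \<Longrightarrow> is_rmc T u (tree_root t)"
  unfolding is_rmc_def by blast

lemma is_ilsI: "Node w (as @ s # t # bs) \<in> subtrees T \<Longrightarrow> is_ils T (tree_root t) (tree_root s)"
  unfolding is_ils_def by blast

lemma is_rmc_mono: "is_rmc s u v \<Longrightarrow> s \<in> subtrees T \<Longrightarrow> is_rmc T u v"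
  unfolding is_rmc_def using subtrees_trans by blast

lemma is_ils_mono: "is_ils s u v \<Longrightarrow> s \<in> subtrees T \<Longrightarrow> is_ils T u v"
  unfolding is_ils_def using subtrees_trans by blast

lemma is_rmc_position:
  assumes "ordered_tree T" "Node w (as @ s # bs) \<in> subtrees T" "is_rmc T u (tree_root s)"
  shows "u = w \<and> bs = []"
proof -
  obtain us t where "Node u (us @ [t]) \<in> subtrees T" "tree_root s = tree_root t"
    using assms(3) unfolding is_rmc_def by metis
  from branch_position_unique[OF assms(1,2) this] show ?thesis by simp
qed

lemma is_ils_position:
  assumes "ordered_tree T" "Node w (as @ s # bs) \<in> subtrees T" "is_ils T u (tree_root s)"
  obtains t bs' where "bs = t # bs'" "tree_root t = u"
proof -
  obtain x us s' t ts where "Node x (us @ s' # t # ts) \<in> subtrees T" "tree_root s = tree_root s'"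
    "tree_root t = u"
    using assms(3) unfolding is_ils_def by metis
  then show ?thesis using that branch_position_unique[OF assms(1,2)] by metis
qed

lemma is_rmc_children:
  assumes "ordered_tree T" "Node u us \<in> subtrees T" "is_rmc T u v"
  obtains as b where "us = as @ [b]" "tree_root b = v"
proof -
  obtain as b where "Node u (as @ [b]) \<in> subtrees T" "tree_root b = v"
    using assms(3) unfolding is_rmc_def by metis
  then show ?thesis using that subtree_unique[OF assms(1,2)] by fastforce
qed

lemma is_ils_before:
  assumes "ordered_tree T" "Node w (ts @ t # bs) \<in> subtrees T" "is_ils T (tree_root t) v"
  obtains as b where "ts = as @ [b]" "tree_root b = v"
proof -
  obtain y as s t' cs where "Node y ((as @ [s]) @ t' # cs) \<in> subtrees T" "tree_root s = v"
    "tree_root t = tree_root t'"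
    using assms(3) unfolding is_ils_def by auto
  then show ?thesis using that branch_position_unique[OF assms(1,2)] by metis
qed

lemma vertex_is_branch:
  assumes "v \<in> vertices T" "v \<noteq> tree_root T"
  obtains w as vs bs where "Node w (as @ Node v vs # bs) \<in> subtrees T"
proof -
  have "\<exists>w as vs bs. Node w (as @ Node v vs # bs) \<in> subtrees T"
    using assms
  proof (induction T)
    case (Node r ts)
    then obtain t where t: "t \<in> set ts" "v \<in> vertices t" by auto
    show ?case
    proof (cases "v = tree_root t")
      case True
      obtain as bs where "ts = as @ t # bs" using t(1) by (meson split_list)
      then have "Node r (as @ Node v (branches t) # bs) \<in> subtrees (Node r ts)"
        using True by simp
      then show ?thesis by blast
    next
      case False
      then have "\<exists>w as vs bs. Node w (as @ Node v vs # bs) \<in> subtrees t" using Node t by blast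
      then show ?thesis using t(1) by (metis UN_I insertI2 subtrees.simps)
    qed
  qed
  then show ?thesis using that by blast
qed

lemma subtree_verts_eq:
  assumes "ordered_tree T" "Node v vs \<in> subtrees T"
  shows "subtree_verts T v = vertices (Node v vs)"
proof (intro equalityI subsetI)
  fix x assume "x \<in> subtree_verts T v"
  then have "(v, x) \<in> (child_rel T)\<^sup>*" by (simp add: subtree_verts_def)
  then show "x \<in> vertices (Node v vs)"
  proof (induction rule: rtrancl_induct)
    case (step y z)
    from step.hyps(2) obtain ys t where
      ys: "Node y ys \<in> subtrees T" "t \<in> set ys" "z = tree_root t"
      unfolding child_rel_def by blast
    obtain ys' where ys': "Node y ys' \<in> subtrees (Node v vs)"
      using vertex_subtree[OF step.IH] by blast
    \<comment> \<open>The subtree at \<open>y\<close> found inside \<open>Node v vs\<close> is the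
      one that witnesses the edge to \<open>z\<close>, because labels determine subtrees.\<close>
    have "Node y ys' = Node y ys"
      using subtrees_trans[OF ys' assms(2)] ys(1) by (rule subtree_unique[OF assms(1)]) simp
    then have "z \<in> vertices (Node y ys')" using ys by (auto intro!: bexI[of _ t])
    then show ?case using vertices_subtree[OF ys'] by blast
  qed simp
next
  have path: "(tree_root t, x) \<in> (child_rel T)\<^sup>*" if "x \<in> vertices t" "t \<in> subtrees T" for t x
    using that
  proof (induction t)
    case (Node u us)
    show ?case
    proof (cases "x = u")
      case False
      then obtain t where t: "t \<in> set us" "x \<in> vertices t" using Node.prems(1) by auto
      have "(u, tree_root t) \<in> child_rel T"
        using Node.prems(2) t(1) by (auto simp: child_rel_def)
      moreover have "(tree_root t, x) \<in> (child_rel T)\<^sup>*"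
        by (rule Node.IH[OF t branch_subtree[OF Node.prems(2) t(1)]])
      ultimately show ?thesis by (simp add: converse_rtrancl_into_rtrancl)
    qed simp
  qed
  fix x assume "x \<in> vertices (Node v vs)"
  then have "(v, x) \<in> (child_rel T)\<^sup>*" using path[OF _ assms(2)] by simp
  then show "x \<in> subtree_verts T v" by (simp add: subtree_verts_def)
qed

section \<open>The dual tree\<close>

text \<open>In the dual, the children of a vertex that is not the root are generated from its left siblings,
  and the siblings to its left from its own children; hence the recursion from the right end.\<close>

function dual_forest :: "'a otree list \<Rightarrow> 'a otree list" where
  "dual_forest [] = []"
| "dual_forest (ts @ [Node u us]) = dual_forest us @ [Node u (dual_forest ts)]"
  by (metis otree.exhaust rev_exhaust) auto
termination
  by (relation "measure (size_list size)") (auto simp: size_list_append)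

lemma vertices_dual_forest:
  "(\<Union>t\<in>set (dual_forest ts). vertices t) = (\<Union>t\<in>set ts. vertices t)"
  by (induction ts rule: dual_forest.induct) auto

lemma distinct_dual_forest:
  "distinct (concat (map preorder ts)) \<Longrightarrow> distinct (concat (map preorder (dual_forest ts)))"
proof (induction ts rule: dual_forest.induct)
  case (2 ts u us)
  have "set (concat (map preorder (dual_forest ts))) = set (concat (map preorder ts))" for ts :: "'a otree list"
    using vertices_dual_forest[of ts] by (simp add: set_preorder)
  with 2 show ?case by auto
qed simp

text \<open>As \<open>is_ils (Node a ts)\<close> does not depend on \<open>a\<close>, it serves as the sibling relation of the forest
  \<open>ts\<close>, with an arbitrary \<open>a\<close>.\<close>

lemma is_ils_Node:
  "is_ils (Node a ts) u v \<longleftrightarrow>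
     (\<exists>as s t bs. ts = as @ s # t # bs \<and> tree_root s = v \<and> tree_root t = u) \<or>
     (\<exists>t\<in>set ts. is_ils t u v)"
    (is "?L \<longleftrightarrow> ?R")
proof
  assume ?L
  then obtain w as s t bs where *: "Node w (as @ s # t # bs) \<in> subtrees (Node a ts)"
    "tree_root s = v" "tree_root t = u" unfolding is_ils_def by blast
  then have "as @ s # t # bs = ts \<or> (\<exists>c\<in>set ts. Node w (as @ s # t # bs) \<in> subtrees c)" by auto
  then show ?R
  proof
    assume "as @ s # t # bs = ts"
    then show ?R using *(2,3) by blast
  next
    assume "\<exists>c\<in>set ts. Node w (as @ s # t # bs) \<in> subtrees c"
    then show ?R using *(2,3) is_ilsI[of w as s t bs] by blast
  qed
next
  assume ?R
  then show ?L
  proof (elim disjE exE conjE bexE)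
    fix as s t bs assume *: "ts = as @ s # t # bs" "tree_root s = v" "tree_root t = u"
    then show ?L using is_ilsI[of a as s t bs] by simp
  next
    fix t assume "t \<in> set ts" "is_ils t u v"
    then show ?L
      using is_ils_mono[of t u v "Node a ts"] branch_subtree[of a ts "Node a ts" t] by simp
  qed
qed

lemma is_rmc_Node:
  "is_rmc (Node a ts) u v \<longleftrightarrow>
     (u = a \<and> (\<exists>as t. ts = as @ [t] \<and> tree_root t = v)) \<or> (\<exists>t\<in>set ts. is_rmc t u v)"
    (is "?L \<longleftrightarrow> ?R")
proof
  assume ?L
  then obtain as t where *: "Node u (as @ [t]) \<in> subtrees (Node a ts)" "tree_root t = v"
    unfolding is_rmc_def by blast
  then have "u = a \<and> ts = as @ [t] \<or> (\<exists>c\<in>set ts. Node u (as @ [t]) \<in> subtrees c)" by auto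
  then show ?R
  proof
    assume "u = a \<and> ts = as @ [t]"
    then show ?R using *(2) by blast
  next
    assume "\<exists>c\<in>set ts. Node u (as @ [t]) \<in> subtrees c"
    then show ?R using *(2) is_rmcI[of u as t] by blast
  qed
next
  assume ?R
  then show ?L
  proof (elim disjE exE conjE bexE)
    fix as t assume *: "u = a" "ts = as @ [t]" "tree_root t = v"
    then show ?L using is_rmcI[of a as t] by simp
  next
    fix t assume "t \<in> set ts" "is_rmc t u v"
    then show ?L
      using is_rmc_mono[of t u v "Node a ts"] branch_subtree[of a ts "Node a ts" t] by simp
  qed
qed

lemma is_ils_append:
  assumes "is_ils (Node a ts) u v" shows "is_ils (Node b (ts @ ts')) u v"
proof (cases "\<exists>t\<in>set ts. is_ils t u v")
  case True
  then show ?thesis by (auto simp: is_ils_Node)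
next
  case False
  then obtain as s t bs where "ts = as @ s # t # bs" "tree_root s = v" "tree_root t = u"
    using assms unfolding is_ils_Node by blast
  then show ?thesis using is_ilsI[of b as s t "bs @ ts'"] by simp
qed

text \<open>The recursion keeps the last root in last place. This identifies the rightmost child
  wherever a dual forest serves as a list of children.\<close>

lemma dual_forest_snoc:
  "\<exists>as us. dual_forest (ts @ [t]) = as @ [Node (tree_root t) us]"
  by (cases t) auto

text \<open>Clause (2) for the constructed dual. The only new pair in the recursion is the last root
  \<open>x\<close> with its rightmost child: \<open>dual_forest us\<close> is placed directly before
  \<open>x\<close> and ends in that child.\<close>

lemma is_ils_dual_forest:
  "\<exists>t\<in>set ts. is_rmc t u v \<Longrightarrow> is_ils (Node a (dual_forest ts)) u v"
proof (induction ts arbitrary: a rule: dual_forest.induct)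
  case (2 ts x us)
  from 2(3) consider "\<exists>t\<in>set ts. is_rmc t u v" | "\<exists>t\<in>set us. is_rmc t u v"
    | bs t where "u = x" "us = bs @ [t]" "tree_root t = v"
    by (auto simp: is_rmc_Node)
  then show ?case
  proof cases
    case 1
    then have "is_ils (Node x (dual_forest ts)) u v" using 2 by blast
    then show ?thesis by (simp add: is_ils_Node[of a])
  next
    case 2
    then show ?thesis using "2.IH"(1) is_ils_append by fastforce
  next
    case 3
    obtain as vs where "dual_forest us = as @ [Node v vs]"
      using dual_forest_snoc[of bs t] 3 by auto
    then show ?thesis using 3 unfolding is_ils_Node by fastforce
  qed
qed simp

text \<open>Clause (3) for the constructed dual. The only new pair is the last root \<open>x\<close>
  with the root just before it, which is the last root of \<open>ts\<close> and hence of the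
  children \<open>dual_forest ts\<close> given to \<open>x\<close>.\<close>

lemma is_rmc_dual_forest:
  "is_ils (Node a ts) u v \<Longrightarrow> \<exists>t\<in>set (dual_forest ts). is_rmc t u v"
proof (induction ts arbitrary: a rule: dual_forest.induct)
  case 1
  then show ?case by (simp add: is_ils_Node)
next
  case (2 ts x us)
  from 2(3) consider "is_ils (Node a ts) u v" | "is_ils (Node x us) u v"
    | bs s where "ts = bs @ [s]" "tree_root s = v" "u = x"
  proof (cases "\<exists>t\<in>set (ts @ [Node x us]). is_ils t u v")
    case True
    then show ?thesis using that(1,2) by (metis Un_iff is_ils_Node set_append singletonD list.set(1,2))
  next
    case False
    then obtain as s t bs where *: "ts @ [Node x us] = as @ s # t # bs" "tree_root s = v" "tree_root t = u"
      using 2(3) unfolding is_ils_Node by blast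
    show ?thesis
    proof (cases bs rule: rev_cases)
      case Nil
      then show ?thesis using that(3)[of as s] * by auto
    next
      case (snoc cs c)
      then have "ts = as @ s # t # cs" using * by (metis append_Cons append_assoc butlast_snoc)
      then show ?thesis using that(1) * is_ilsI[of a as s t cs] by simp
    qed
  qed
  then show ?case
  proof cases
    case 1
    then show ?thesis using "2.IH"(2) by (auto simp: is_rmc_Node)
  next
    case 2
    then show ?thesis using "2.IH"(1) by auto
  next
    case 3
    obtain as vs where "dual_forest ts = as @ [Node v vs]"
      using dual_forest_snoc[of bs s] 3 by auto
    then have "is_rmc (Node x (dual_forest ts)) u v" using 3(3) by (simp add: is_rmc_Node)
    then show ?thesis by simp
  qed
qed

section \<open>Existence and uniqueness of the dual tree\<close>

lemma not_child_root:
  assumes "ordered_tree T" shows "(u, tree_root T) \<notin> child_rel T"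
proof
  assume "(u, tree_root T) \<in> child_rel T"
  then obtain ts t where "Node u ts \<in> subtrees T" "t \<in> set ts" "tree_root t = tree_root T"
    by (auto simp: child_rel_def)
  then show False using branch_not_root[OF assms] by (metis split_list)
qed

lemma is_dual_dual_forest:
  assumes "ordered_tree (Node r ts)"
  shows "is_dual (Node r ts) (Node r (dual_forest ts))"
proof -
  have ord: "ordered_tree (Node r (dual_forest ts))"
    using assms by (simp add: ordered_tree_Node vertices_dual_forest distinct_dual_forest)
  have "is_rmc (Node r (dual_forest ts)) r v" if rmc: "is_rmc (Node r ts) r v" for v
  proof -
    obtain us t where "Node r (us @ [t]) \<in> subtrees (Node r ts)" "tree_root t = v"
      using rmc unfolding is_rmc_def by blast
    moreover from this have "Node r (us @ [t]) = Node r ts"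
      by (intro subtree_unique[OF assms]) auto
    ultimately show ?thesis using dual_forest_snoc[of us t] by (auto simp: is_rmc_Node)
  qed
  moreover have "is_ils (Node r (dual_forest ts)) u v" if "is_rmc (Node r ts) u v" "u \<noteq> r" for u v
    using that by (auto simp: is_rmc_Node intro: is_ils_dual_forest)
  moreover have "is_rmc (Node r (dual_forest ts)) u v" if "is_ils (Node r ts) u v" for u v
    using is_rmc_dual_forest[OF that] by (auto simp: is_rmc_Node)
  ultimately show ?thesis
    using ord not_child_root[OF ord] by (simp add: is_dual_def vertices_dual_forest)
qed

text \<open>The clauses of \<open>is_dual\<close> only lead from \<open>T\<close> to
  \<open>S\<close>; for uniqueness they must be reversed. The position of \<open>v\<close> in
  \<open>T\<close> triggers one clause, which places \<open>v\<close> in \<open>S\<close>, and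
  \<open>v\<close> has only one position there.\<close>

lemma is_dual_is_rmc:
  assumes T: "ordered_tree T" and S: "is_dual T S" and rmc: "is_rmc S u v"
  shows "is_ils T u v \<or> u = tree_root T \<and> is_rmc T u v"
proof -
  have ord: "ordered_tree S" using S by (simp add: is_dual_def)
  obtain us t where t: "Node u (us @ [t]) \<in> subtrees S" "tree_root t = v"
    using rmc unfolding is_rmc_def by blast
  have "t \<in> subtrees S" by (rule branch_subtree[OF t(1)]) simp
  then have "v \<in> vertices T"
    using vertices_subtree t(2) S tree_root_in_vertices unfolding is_dual_def by blast
  moreover have "v \<noteq> tree_root T"
    using branch_not_root[OF ord t(1)] t(2) S by (simp add: is_dual_def)
  ultimately obtain w as vs bs where w: "Node w (as @ Node v vs # bs) \<in> subtrees T"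
    by (rule vertex_is_branch)
  show ?thesis
  proof (cases bs)
    case Nil
    then have wv: "is_rmc T w v" using is_rmcI[of w as "Node v vs"] w by simp
    \<comment> \<open>Otherwise clause (2) would give \<open>v\<close> a right sibling in
      \<open>S\<close>, where it is a last child.\<close>
    have "w = tree_root T"
    proof (rule ccontr)
      assume "w \<noteq> tree_root T"
      then have "is_ils S w (tree_root t)" using S wv t(2) unfolding is_dual_def by blast
      then show False by (rule is_ils_position[OF ord t(1)]) simp
    qed
    moreover from this have "is_rmc S w (tree_root t)"
      using S wv t(2) unfolding is_dual_def by blast
    then have "w = u" using is_rmc_position[OF ord t(1)] by simp
    ultimately show ?thesis using wv by simp
  next
    case (Cons b bs')
    then have ils: "is_ils T (tree_root b) v" using is_ilsI[of w as "Node v vs" b bs'] w by simp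
    then have "is_rmc S (tree_root b) (tree_root t)"
      using S t(2) unfolding is_dual_def by blast
    then have "tree_root b = u" using is_rmc_position[OF ord t(1)] by simp
    then show ?thesis using ils by simp
  qed
qed

lemma is_dual_is_ils:
  assumes T: "ordered_tree T" and S: "is_dual T S" and ils: "is_ils S u v"
  shows "is_rmc T u v"
proof -
  have ord: "ordered_tree S" using S by (simp add: is_dual_def)
  obtain x us s t ts where st: "Node x (us @ s # t # ts) \<in> subtrees S" "tree_root s = v" "tree_root t = u"
    using ils unfolding is_ils_def by blast
  have "s \<in> subtrees S" by (rule branch_subtree[OF st(1)]) simp
  then have "v \<in> vertices T"
    using vertices_subtree st(2) S tree_root_in_vertices unfolding is_dual_def by blast
  moreover have "v \<noteq> tree_root T"
    using branch_not_root[OF ord st(1)] st(2) S by (simp add: is_dual_def)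
  ultimately obtain w as vs bs where w: "Node w (as @ Node v vs # bs) \<in> subtrees T"
    by (rule vertex_is_branch)
  \<comment> \<open>In \<open>S\<close> the vertex \<open>v\<close> has the right sibling
    \<open>t\<close>. This excludes clauses (1b) and (3), so only clause (2) can have placed
    \<open>v\<close>.\<close>
  have no_rmc: "\<not> is_rmc S y v" for y
    using st(2) is_rmc_position[OF ord st(1)] by blast
  show ?thesis
  proof (cases bs)
    case Nil
    then have wv: "is_rmc T w v" using is_rmcI[of w as "Node v vs"] w by simp
    with no_rmc S have "w \<noteq> tree_root T" unfolding is_dual_def by blast
    then have "is_ils S w (tree_root s)" using S wv st(2) unfolding is_dual_def by blast
    then have "u = w" by (rule is_ils_position[OF ord st(1)]) (use st(3) in simp)
    then show ?thesis using wv by simp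
  next
    case (Cons b bs')
    then have "is_ils T (tree_root b) v" using is_ilsI[of w as "Node v vs" b bs'] w by simp
    then show ?thesis using no_rmc S unfolding is_dual_def by blast
  qed
qed

text \<open>For the induction, \<open>ts\<close> and \<open>ss\<close> are initial parts of sibling
  lists in \<open>T\<close> and \<open>S\<close>, tied together only by their last roots. From that
  root leftwards, \<open>S\<close> is forced: siblings before it come from its children in
  \<open>T\<close>, and its children from its left siblings in \<open>T\<close>.\<close>

lemma is_dual_forest_unique:
  assumes T: "ordered_tree T" and S: "is_dual T S"
    and "Node w (ts @ rest) \<in> subtrees T" "Node x (ss @ rest') \<in> subtrees S"
    and "ts = [] \<longleftrightarrow> ss = []" "ts \<noteq> [] \<Longrightarrow> tree_root (last ts) = tree_root (last ss)"
  shows "ss = dual_forest ts"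
  using assms(3-)
proof (induction ts arbitrary: w rest x ss rest' rule: dual_forest.induct)
  case (2 ts u us)
  have ord: "ordered_tree S" using S by (simp add: is_dual_def)
  obtain ss' c where "ss = ss' @ [c]" using 2(5) by (cases ss rule: rev_cases) auto
  moreover from this obtain cs where "c = Node u cs" using 2(6) by (cases c) auto
  ultimately have ss: "ss = ss' @ [Node u cs]" by simp
  have uT: "Node u us \<in> subtrees T" by (rule branch_subtree[OF 2(3)]) simp
  have uS: "Node u cs \<in> subtrees S" by (rule branch_subtree[OF 2(4)]) (simp add: ss)
  have wT: "Node w (ts @ Node u us # rest) \<in> subtrees T" using 2(3) by simp
  have xS: "Node x (ss' @ Node u cs # rest') \<in> subtrees S" using 2(4) ss by simp
  have ur: "u \<noteq> tree_root T" using branch_not_root[OF T wT] by simp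
  \<comment> \<open>The next four facts provide the side conditions of the two induction hypotheses.
    Clause (2) and its converse match \<open>us\<close> with \<open>ss'\<close>; clause (3) and its
    converse match \<open>ts\<close> with \<open>cs\<close>, where \<open>ur\<close> excludes the
    exceptional root case.\<close>
  have us: "\<exists>bs b. ss' = bs @ [b] \<and> tree_root b = tree_root a" if "us = as @ [a]" for as a
  proof -
    have "is_ils S u (tree_root a)"
      using is_rmcI[of u as a T] uT that S ur unfolding is_dual_def by blast
    then show ?thesis using is_ils_before[OF ord xS] by (metis otree.sel(1))
  qed
  have ss': "us \<noteq> []" if "ss' = as @ [a]" for as a
  proof -
    have "is_ils S u (tree_root a)" using is_ilsI[of x as a "Node u cs" rest' S] xS that by simp
    then show ?thesis using is_rmc_children[OF T uT] is_dual_is_ils[OF T S] by blast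
  qed
  have ts: "\<exists>bs b. cs = bs @ [b] \<and> tree_root b = tree_root a" if "ts = as @ [a]" for as a
  proof -
    have "is_ils T u (tree_root a)" using is_ilsI[of w as a "Node u us" rest T] wT that by simp
    then have "is_rmc S u (tree_root a)" using S unfolding is_dual_def by blast
    then show ?thesis using is_rmc_children[OF ord uS] by metis
  qed
  have cs: "ts \<noteq> []" if "cs = as @ [a]" for as a
  proof -
    have "is_ils T u (tree_root a)"
      using is_rmcI[of u as a S] uS that is_dual_is_rmc[OF T S] ur by blast
    then show ?thesis using is_ils_before[OF T wT] by (metis otree.sel(1) snoc_eq_iff_butlast)
  qed
  have "ss' = dual_forest us"
  proof (rule "2.IH"(1))
    show "Node u (us @ []) \<in> subtrees T" using uT by simp
    show "Node x (ss' @ (Node u cs # rest')) \<in> subtrees S" by (rule xS)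
    show "us = [] \<longleftrightarrow> ss' = []" using us ss' by (metis rev_exhaust snoc_eq_iff_butlast)
    show "tree_root (last us) = tree_root (last ss')" if "us \<noteq> []"
      using us[OF append_butlast_last_id[OF that, symmetric]] by auto
  qed
  moreover have "cs = dual_forest ts"
  proof (rule "2.IH"(2))
    show "Node w (ts @ (Node u us # rest)) \<in> subtrees T" by (rule wT)
    show "Node u (cs @ []) \<in> subtrees S" using uS by simp
    show "ts = [] \<longleftrightarrow> cs = []" using ts cs by (metis rev_exhaust snoc_eq_iff_butlast)
    show "tree_root (last ts) = tree_root (last cs)" if "ts \<noteq> []"
      using ts[OF append_butlast_last_id[OF that, symmetric]] by auto
  qed
  ultimately show ?case using ss by simp
qed simp

lemma is_dual_unique:
  assumes T: "ordered_tree (Node r ts)" and S: "is_dual (Node r ts) S"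
  shows "S = Node r (dual_forest ts)"
proof -
  have ord: "ordered_tree S" using S by (simp add: is_dual_def)
  obtain ss where ss: "S = Node r ss" using S by (cases S) (auto simp: is_dual_def)
  have ssS: "Node r ss \<in> subtrees S" using ss by simp
  have fwd: "\<exists>as b. ss = as @ [b] \<and> tree_root b = tree_root (last ts)" if "ts \<noteq> []"
  proof -
    have "is_rmc (Node r ts) r (tree_root (last ts))"
      using is_rmcI[of r "butlast ts" "last ts"] that by simp
    then have "is_rmc S r (tree_root (last ts))" using S unfolding is_dual_def by simp
    then show ?thesis using is_rmc_children[OF ord ssS] by metis
  qed
  \<comment> \<open>If \<open>ts\<close> is empty, \<open>r\<close> is the only label available in
    \<open>S\<close>, so a child of \<open>r\<close> in \<open>S\<close> would repeat it.\<close>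
  have bwd: "ts \<noteq> []" if "ss \<noteq> []"
  proof
    assume "ts = []"
    then have "vertices S = {r}" using S by (simp add: is_dual_def)
    moreover have "tree_root (hd ss) \<in> (\<Union>t\<in>set ss. vertices t)"
      using that hd_in_set tree_root_in_vertices by blast
    ultimately show False using ss ord by (auto simp: ordered_tree_Node)
  qed
  have "ss = dual_forest ts"
  proof (rule is_dual_forest_unique[OF T S])
    show "Node r (ts @ []) \<in> subtrees (Node r ts)" "Node r (ss @ []) \<in> subtrees S" using ss by auto
    show "ts = [] \<longleftrightarrow> ss = []" using fwd bwd by blast
    show "tree_root (last ts) = tree_root (last ss)" if "ts \<noteq> []" using fwd[OF that] by auto
  qed
  then show ?thesis using ss by simp
qed

section \<open>The dual tree and its descendant sets\<close>

lemma dual_tree_eq: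
  assumes "ordered_tree (Node r ts)"
  shows "dual_tree (Node r ts) = Node r (dual_forest ts)"
  unfolding dual_tree_def
  using is_dual_dual_forest[OF assms] is_dual_unique[OF assms] by (intro the_equality)

text \<open>The recursion strips last trees or descends into their children until
  \<open>Node v vs\<close> is itself last; what then remains to its left is exactly
  \<open>as\<close>, which supplies the dual children of \<open>v\<close>.\<close>

lemma subtrees_dual_forest:
  assumes "Node w (as @ Node v vs # bs) \<in> subtrees (Node a ts)"
  shows "\<exists>t\<in>set (dual_forest ts). Node v (dual_forest as) \<in> subtrees t"
  using assms
proof (induction ts arbitrary: a w bs rule: dual_forest.induct)
  case (2 ts u us)
  have IH1: ?case if "Node w (as @ Node v vs # bs) \<in> subtrees (Node u us)"
    using "2.IH"(1)[OF that] by auto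
  have IH2: ?case if "Node w (as @ Node v vs # bs) \<in> subtrees (Node a ts)" for w bs
    using "2.IH"(2)[OF that] by auto
  from 2(3) consider "as @ Node v vs # bs = ts @ [Node u us]"
    | "Node w (as @ Node v vs # bs) \<in> subtrees (Node u us)"
    | "\<exists>t\<in>set ts. Node w (as @ Node v vs # bs) \<in> subtrees t" by auto
  then show ?case
  proof cases
    case 1
    show ?thesis
    proof (cases bs rule: rev_cases)
      case Nil
      with 1 show ?thesis by auto
    next
      case (snoc cs c)
      then have "ts = as @ Node v vs # cs" using 1 by (metis append_Cons append_assoc butlast_snoc)
      then have "Node a (as @ Node v vs # cs) \<in> subtrees (Node a ts)" by simp
      then show ?thesis by (rule IH2)
    qed
  next
    case 2 then show ?thesis by (rule IH1)
  next
    case 3 then show ?thesis by (intro IH2[of w bs]) auto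
  qed
qed auto

lemma dual_subtree_verts:
  assumes "ordered_tree T" "Node w (as @ Node v vs # bs) \<in> subtrees T"
  shows "subtree_verts (dual_tree T) v = insert v (\<Union>s\<in>set as. vertices s)"
proof (cases T)
  case (Node r ts)
  have dual: "dual_tree T = Node r (dual_forest ts)" using dual_tree_eq assms(1) Node by simp
  have "ordered_tree (dual_tree T)"
    using is_dual_dual_forest[of r ts] assms(1) Node dual by (simp add: is_dual_def)
  moreover have "Node v (dual_forest as) \<in> subtrees (dual_tree T)"
    using subtrees_dual_forest[of w as v vs bs r ts] assms(2) dual Node by simp
  ultimately show ?thesis using subtree_verts_eq by (fastforce simp: vertices_dual_forest)
qed

section \<open>Depth along the preorder\<close>

text \<open>The preorder list with each vertex tagged by its level, counted from \<open>d\<close> at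
  the root. It carries order and depth together, whereas \<open>depth\<close> is a least path length
  in an undirected graph.\<close>

fun preorder_depths :: "nat \<Rightarrow> 'a otree \<Rightarrow> ('a \<times> nat) list" where
  "preorder_depths d (Node x ts) = (x, d) # concat (map (preorder_depths (Suc d)) ts)"

lemma map_fst_preorder_depths [simp]: "map fst (preorder_depths d T) = preorder T"
  by (induction d T rule: preorder_depths.induct) (simp add: map_concat comp_def cong: map_cong)

lemma preorder_depths_ge: "(x, k) \<in> set (preorder_depths d T) \<Longrightarrow> d \<le> k"
  by (induction d T rule: preorder_depths.induct) fastforce

lemma tree_root_preorder_depths: "(tree_root T, d) \<in> set (preorder_depths d T)"
  by (cases T) auto

text \<open>A subtree fills a contiguous block of the list, its levels shifted to start at some
  \<open>k\<close>. Contiguity is what makes preorder intervals accessible as segments.\<close>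

lemma preorder_depths_subtree:
  "s \<in> subtrees T \<Longrightarrow> \<exists>A k E. preorder_depths d T = A @ preorder_depths k s @ E"
proof (induction T arbitrary: d)
  case (Node x ts)
  show ?case
  proof (cases "s = Node x ts")
    case True
    then have "preorder_depths d (Node x ts) = [] @ preorder_depths d s @ []" by simp
    then show ?thesis by blast
  next
    case False
    then obtain t where t: "t \<in> set ts" "s \<in> subtrees t" using Node.prems by auto
    obtain as bs where ts: "ts = as @ t # bs" using t(1) by (meson split_list)
    obtain A k E where "preorder_depths (Suc d) t = A @ preorder_depths k s @ E"
      using Node.IH[OF t] by blast
    then have "preorder_depths d (Node x ts) =
        ((x, d) # concat (map (preorder_depths (Suc d)) as) @ A) @ preorder_depths k s @
        (E @ concat (map (preorder_depths (Suc d)) bs))"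
      using ts by simp
    then show ?thesis by blast
  qed
qed

lemma preorder_depths_child:
  assumes "(u, v) \<in> child_rel T"
  shows "\<exists>k. (u, k) \<in> set (preorder_depths d T) \<and> (v, Suc k) \<in> set (preorder_depths d T)"
proof -
  obtain ts t where t: "Node u ts \<in> subtrees T" "t \<in> set ts" "v = tree_root t"
    using assms unfolding child_rel_def by blast
  obtain A k E where *: "preorder_depths d T = A @ preorder_depths k (Node u ts) @ E"
    using preorder_depths_subtree[OF t(1)] by blast
  have "(v, Suc k) \<in> set (preorder_depths k (Node u ts))"
    using t tree_root_preorder_depths[of t "Suc k"] by auto
  then show ?thesis using * by auto
qed

lemma relpow_mono_rel:
  fixes R S :: "('b \<times> 'b) set"
  shows "R \<subseteq> S \<Longrightarrow> R ^^ n \<subseteq> S ^^ n"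
  by (induction n) (auto simp: relcomp_mono)

lemma preorder_depths_path:
  "(x, k) \<in> set (preorder_depths d T) \<Longrightarrow> (tree_root T, x) \<in> child_rel T ^^ (k - d)"
proof (induction T arbitrary: d)
  case (Node u ts)
  show ?case
  proof (cases "(x, k) = (u, d)")
    case False
    then obtain t where t: "t \<in> set ts" "(x, k) \<in> set (preorder_depths (Suc d) t)"
      using Node.prems by auto
    have "child_rel t \<subseteq> child_rel (Node u ts)" using t(1) by (auto simp: child_rel_def)
    then have "(tree_root t, x) \<in> child_rel (Node u ts) ^^ (k - Suc d)"
      using relpow_mono_rel Node.IH[OF t] by blast
    moreover have "(u, tree_root t) \<in> child_rel (Node u ts)"
      using t(1) by (auto simp: child_rel_def)
    ultimately have "(u, x) \<in> child_rel (Node u ts) ^^ Suc (k - Suc d)"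
      by (intro relpow_Suc_I2)
    moreover have "Suc (k - Suc d) = k - d" using preorder_depths_ge[OF t(2)] by simp
    ultimately show ?thesis by simp
  qed simp
qed

lemma preorder_depths_unique:
  assumes "ordered_tree T" "(x, j) \<in> set (preorder_depths d T)" "(x, k) \<in> set (preorder_depths d T)"
  shows "j = k"
  using assms eq_key_imp_eq_value[of "preorder_depths d T" x j k] by (simp add: ordered_tree_def)

text \<open>The downward path from the root has length equal to the level. No path is shorter, since
  an edge in either direction raises the level by at most one.\<close>

lemma depth_eq:
  assumes T: "ordered_tree T" and x: "(x, k) \<in> set (preorder_depths 0 T)"
  shows "depth T x = k"
  unfolding depth_def tree_dist_def
proof (rule Least_equality)
  show "(tree_root T, x) \<in> (child_rel T \<union> (child_rel T)\<inverse>) ^^ k"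
    using preorder_depths_path[OF x] relpow_mono_rel[of "child_rel T" "child_rel T \<union> (child_rel T)\<inverse>" k]
    by auto
  fix n assume "(tree_root T, x) \<in> (child_rel T \<union> (child_rel T)\<inverse>) ^^ n"
  then show "k \<le> n" using x
  proof (induction n arbitrary: x k)
    case 0
    then show ?case using preorder_depths_unique[OF T _ tree_root_preorder_depths] by auto
  next
    case (Suc n)
    from Suc.prems(1) obtain y where y: "(tree_root T, y) \<in> (child_rel T \<union> (child_rel T)\<inverse>) ^^ n"
      "(y, x) \<in> child_rel T \<or> (x, y) \<in> child_rel T" by auto
    then obtain i j where ij: "(y, i) \<in> set (preorder_depths 0 T)" "(x, j) \<in> set (preorder_depths 0 T)"
      "j \<le> Suc i" using preorder_depths_child by (metis le_SucI le_refl)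
    have "k = j" using preorder_depths_unique[OF T] Suc.prems(2) ij(2) by blast
    then show ?case using Suc.IH[OF y(1) ij(1)] ij(3) by simp
  qed
qed

section \<open>Intervals and maxima of the preorder\<close>

lemma preorder_le_nth:
  assumes "ordered_tree T" "p < length (preorder T)" "q < length (preorder T)"
  shows "preorder_le T (preorder T ! p) (preorder T ! q) \<longleftrightarrow> p \<le> q"
proof
  assume "preorder_le T (preorder T ! p) (preorder T ! q)"
  then obtain i j where "i \<le> j" "j < length (preorder T)" "preorder T ! i = preorder T ! p"
    "preorder T ! j = preorder T ! q" unfolding preorder_le_def by blast
  then show "p \<le> q"
    using assms nth_eq_iff_index_eq unfolding ordered_tree_def by (metis order.strict_trans1)
next
  assume "p \<le> q"
  then show "preorder_le T (preorder T ! p) (preorder T ! q)"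
    using assms(3) unfolding preorder_le_def by blast
qed

lemma preorder_le_antisym:
  assumes "ordered_tree T" "preorder_le T x y" "preorder_le T y x"
  shows "x = y"
proof -
  obtain p q where "p < length (preorder T)" "q < length (preorder T)"
    "x = preorder T ! p" "y = preorder T ! q"
    using assms(2) unfolding preorder_le_def by (metis order.strict_trans1)
  then show ?thesis using assms preorder_le_nth by (metis le_antisym)
qed

text \<open>Distinct labels make positions and vertices interchangeable, so being between the ends
  of a segment \<open>M\<close> is a comparison of indices.\<close>

lemma preorder_interval:
  assumes T: "ordered_tree T" and seg: "preorder T = A @ M @ E" and "M \<noteq> []"
  shows "preorder_le T (hd M) x \<and> preorder_le T x (last M) \<longleftrightarrow> x \<in> set M"
proof -
  let ?xs = "preorder T" and ?a = "length A" and ?m = "length M"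
  have m: "?m > 0" using \<open>M \<noteq> []\<close> by simp
  have hd: "hd M = ?xs ! ?a" using seg \<open>M \<noteq> []\<close> by (simp add: hd_conv_nth nth_append)
  have nth: "?xs ! (?a + i) = M ! i" if "i < ?m" for i using seg that by (simp add: nth_append)
  have last: "last M = ?xs ! (?a + ?m - 1)"
    using nth[of "?m - 1"] m \<open>M \<noteq> []\<close> by (simp add: last_conv_nth)
  have len: "?a + ?m \<le> length ?xs" using seg by simp
  show ?thesis
  proof
    assume *: "preorder_le T (hd M) x \<and> preorder_le T x (last M)"
    then obtain q where q: "q < length ?xs" "x = ?xs ! q" unfolding preorder_le_def by auto
    have "?a \<le> q" using * preorder_le_nth[OF T _ q(1), of ?a] hd q(2) len m by simp
    moreover have "q \<le> ?a + ?m - 1"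
      using * preorder_le_nth[OF T q(1), of "?a + ?m - 1"] last q(2) len m by (simp del: length_greater_0_conv)
    ultimately have "q - ?a < ?m" "?a + (q - ?a) = q" using m by linarith+
    then show "x \<in> set M" using nth[of "q - ?a"] q(2) by simp
  next
    assume "x \<in> set M"
    then obtain i where i: "i < ?m" "x = M ! i" by (auto simp: in_set_conv_nth)
    then have "x = ?xs ! (?a + i)" using nth by simp
    then show "preorder_le T (hd M) x \<and> preorder_le T x (last M)"
      using preorder_le_nth[OF T, of ?a "?a + i"] preorder_le_nth[OF T, of "?a + i" "?a + ?m - 1"]
        i len hd last by simp
  qed
qed

lemma preorder_Max_eq:
  assumes "ordered_tree T" "m \<in> X" "\<And>x. x \<in> X \<Longrightarrow> preorder_le T x m"
  shows "preorder_Max T X = m"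
  unfolding preorder_Max_def using assms by (intro the_equality) (auto intro: preorder_le_antisym)

section \<open>The primal-dual ancestor\<close>

lemma last_shallowest_between:
  assumes T: "ordered_tree T" and sub: "Node w (as @ Node v vs # bs) \<in> subtrees T"
    and v1: "v1 \<in> insert v (\<Union>s\<in>set as. vertices s)" and v2: "v2 \<in> vertices (Node v vs)"
  shows "preorder_Max T {x. preorder_le T v1 x \<and> preorder_le T x v2 \<and>
    depth T x = depth_between T v1 v2} = v"
proof -
  obtain A k E where seg: "preorder_depths 0 T = A @ preorder_depths k (Node w (as @ Node v vs # bs)) @ E"
    using preorder_depths_subtree[OF sub] by blast
  \<comment> \<open>\<open>d\<close> is the level of \<open>v\<close>. \<open>P\<close> lists the
    subtrees at its left siblings and \<open>Q\<close> its proper descendants, so \<open>P\<close>,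
    \<open>v\<close>, \<open>Q\<close> are consecutive in the preorder.\<close>
  define d where "d = Suc k"
  define P where "P = concat (map (preorder_depths d) as)"
  define Q where "Q = concat (map (preorder_depths (Suc d)) vs)"
  have mem: "\<exists>k. (x, k) \<in> set (concat (map (preorder_depths e) ts))"
    if x: "x \<in> (\<Union>t\<in>set ts. vertices t)" for x e and ts :: "'a otree list"
  proof -
    obtain t where t: "t \<in> set ts" "x \<in> vertices t" using x by blast
    then have "x \<in> fst ` set (preorder_depths e t)" by (simp flip: set_map add: set_preorder)
    then obtain k where "(x, k) \<in> set (preorder_depths e t)" by auto
    then show ?thesis using t(1) by auto
  qed
  \<comment> \<open>\<open>P2\<close> is the part of \<open>P\<close> from \<open>v1\<close>
    onwards, empty if \<open>v1 = v\<close>. Likewise \<open>Q1\<close> below is the part of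
    \<open>Q\<close> up to \<open>v2\<close>, empty if \<open>v2 = v\<close>.\<close>
  obtain P1 P2 where P: "P = P1 @ P2" "hd (map fst P2 @ [v]) = v1"
  proof (cases "v1 = v")
    case True
    then show ?thesis using that[of P "[]"] by simp
  next
    case False
    then obtain e where "(v1, e) \<in> set P" using v1 mem[of v1 as d] P_def by auto
    then obtain P1 P2 where "P = P1 @ (v1, e) # P2" by (meson split_list)
    then show ?thesis using that[of P1 "(v1, e) # P2"] by simp
  qed
  obtain Q1 Q2 where Q: "Q = Q1 @ Q2" "last (v # map fst Q1) = v2"
  proof (cases "v2 = v")
    case True
    then show ?thesis using that[of "[]" Q] by simp
  next
    case False
    then obtain e where "(v2, e) \<in> set Q" using v2 mem[of v2 vs "Suc d"] Q_def by auto
    then obtain Q1 Q2 where "Q = Q1 @ (v2, e) # Q2" by (meson split_list)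
    then show ?thesis using that[of "Q1 @ [(v2, e)]" Q2] by simp
  qed
  define M where "M = P2 @ (v, d) # Q1"
  obtain A' E' where seg': "preorder_depths 0 T = A' @ M @ E'"
    using that[of "A @ (w, k) # P1" "Q2 @ concat (map (preorder_depths d) bs) @ E"]
      seg P(1) Q(1) by (simp add: M_def P_def Q_def d_def)
  have pre: "preorder T = map fst A' @ map fst M @ map fst E'"
    using arg_cong[OF seg', of "map fst"] by simp
  have interval: "preorder_le T v1 x \<and> preorder_le T x v2 \<longleftrightarrow> x \<in> fst ` set M" for x
  proof -
    have "hd (map fst M) = v1" "last (map fst M) = v2"
      using P(2) Q(2) by (auto simp: M_def hd_append)
    then show ?thesis using preorder_interval[OF T pre, of x] by (simp add: M_def image_Un)
  qed
  have before: "preorder_le T x v" if "x \<in> fst ` set (P2 @ [(v, d)])" for x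
  proof -
    have "preorder T = map fst A' @ map fst (P2 @ [(v, d)]) @ map fst (Q1 @ E')"
      using pre by (simp add: M_def)
    from preorder_interval[OF T this, of x] that show ?thesis by simp
  qed
  have P2: "d \<le> e" if "(x, e) \<in> set P2" for x e
  proof -
    have "(x, e) \<in> set P" using P(1) that by simp
    then show ?thesis using preorder_depths_ge[of x e d] by (auto simp: P_def)
  qed
  have Q1: "Suc d \<le> e" if "(x, e) \<in> set Q1" for x e
  proof -
    have "(x, e) \<in> set Q" using Q(1) that by simp
    then show ?thesis using preorder_depths_ge[of x e "Suc d"] by (auto simp: Q_def)
  qed
  have depth_M: "depth T x = e" if "(x, e) \<in> set M" for x e
    using depth_eq[OF T] that seg' by simp
  have "depth_between T v1 v2 = d"
    unfolding depth_between_def interval Collect_mem_eq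
  proof (rule Min_eqI)
    show "d \<le> e" if "e \<in> depth T ` fst ` set M" for e
      using that depth_M P2 Q1 by (fastforce simp: M_def)
    show "d \<in> depth T ` fst ` set M" using depth_M[of v d] by (force simp: M_def)
  qed simp
  moreover have "preorder_le T v1 v \<and> preorder_le T v v2" unfolding interval by (simp add: M_def)
  moreover have "depth T v = d" using depth_M by (simp add: M_def)
  moreover have "preorder_le T x v" if x: "preorder_le T v1 x" "preorder_le T x v2" "depth T x = d" for x
  proof -
    obtain e where e: "(x, e) \<in> set M" using x(1,2) interval[of x] by auto
    \<comment> \<open>The bound on \<open>Q1\<close> is strict, so a vertex of depth
      \<open>d\<close> is \<open>v\<close> or lies in \<open>P2\<close>, hence not after
      \<open>v\<close>.\<close>
    then have "(x, e) \<notin> set Q1" using depth_M[OF e] Q1 x(3) by fastforce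
    then show ?thesis using e before[of x] by (force simp: M_def)
  qed
  ultimately show ?thesis by (intro preorder_Max_eq[OF T]) auto
qed

text \<open>Existence of the primal-dual ancestor, by recursion from the right end. If the position
  of the last root \<open>u\<close> lies between \<open>i\<close> and \<open>j\<close> inclusive,
  then \<open>u\<close> is the ancestor; otherwise both positions lie in \<open>ts\<close> or both
  among the proper descendants of \<open>u\<close>.\<close>

lemma primal_dual_split:
  assumes "i < j" "j < length (concat (map preorder ts))"
  shows "\<exists>w as v vs bs. Node w (as @ Node v vs # bs) \<in> subtrees (Node a ts) \<and>
    concat (map preorder ts) ! i \<in> insert v (\<Union>s\<in>set as. vertices s) \<and>
    concat (map preorder ts) ! j \<in> vertices (Node v vs)"
  using assms
proof (induction ts arbitrary: a i j rule: dual_forest.induct)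
  case (2 ts u us)
  let ?xs = "concat (map preorder ts)" and ?ys = "concat (map preorder us)"
  have set_xs: "set ?xs = (\<Union>t\<in>set ts. vertices t)" by (simp add: set_preorder)
  have all: "concat (map preorder (ts @ [Node u us])) = ?xs @ u # ?ys" by simp
  consider "j < length ?xs" | "i \<le> length ?xs" "length ?xs \<le> j" | "length ?xs < i" by linarith
  then show ?case
  proof cases
    case 1
    then obtain w as v vs bs where *: "Node w (as @ Node v vs # bs) \<in> subtrees (Node a ts)"
      "?xs ! i \<in> insert v (\<Union>s\<in>set as. vertices s)" "?xs ! j \<in> vertices (Node v vs)"
      using "2.IH"(2)[OF 2(3) 1, of a] by blast
    \<comment> \<open>The right siblings may change: at top level the appended tree
      \<open>Node u us\<close> becomes one more of them.\<close>
    have "\<exists>bs'. Node w (as @ Node v vs # bs') \<in> subtrees (Node a (ts @ [Node u us]))"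
    proof (cases "Node w (as @ Node v vs # bs) = Node a ts")
      case True
      then have "Node w (as @ Node v vs # (bs @ [Node u us])) \<in> subtrees (Node a (ts @ [Node u us]))"
        by auto
      then show ?thesis by blast
    next
      case False
      then have "Node w (as @ Node v vs # bs) \<in> subtrees (Node a (ts @ [Node u us]))"
        using *(1) by auto
      then show ?thesis by blast
    qed
    moreover have "(?xs @ u # ?ys) ! i = ?xs ! i" "(?xs @ u # ?ys) ! j = ?xs ! j"
      using 1 2(3) by (simp_all add: nth_append)
    ultimately show ?thesis using *(2,3) unfolding all by metis
  next
    case 2
    have "(?xs @ u # ?ys) ! i \<in> insert u (\<Union>t\<in>set ts. vertices t)"
      using 2(1) nth_mem[of i ?xs] unfolding set_xs[symmetric] by (auto simp: nth_append)
    moreover have "(?xs @ u # ?ys) ! j \<in> vertices (Node u us)"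
    proof -
      have "(?xs @ u # ?ys) ! j = (u # ?ys) ! (j - length ?xs)" using 2(2) by (simp add: nth_append)
      moreover have "\<dots> \<in> set (u # ?ys)"
        using "2.prems"(2) 2(2) unfolding all by (intro nth_mem) simp
      ultimately show ?thesis by (simp add: set_preorder)
    qed
    moreover have "Node a (ts @ Node u us # []) \<in> subtrees (Node a (ts @ [Node u us]))" by simp
    ultimately show ?thesis unfolding all by blast
  next
    case 3
    let ?i = "i - Suc (length ?xs)" and ?j = "j - Suc (length ?xs)"
    have "?i < ?j" "?j < length ?ys" using 3 "2.prems" unfolding all by simp_all
    then obtain w as v vs bs where *: "Node w (as @ Node v vs # bs) \<in> subtrees (Node u us)"
      "?ys ! ?i \<in> insert v (\<Union>s\<in>set as. vertices s)" "?ys ! ?j \<in> vertices (Node v vs)"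
      using "2.IH"(1)[of ?i ?j u] by blast
    have "(?xs @ u # ?ys) ! i = ?ys ! ?i" "(?xs @ u # ?ys) ! j = ?ys ! ?j"
      using 3 2(3) by (simp_all add: nth_append)
    moreover have "Node w (as @ Node v vs # bs) \<in> subtrees (Node a (ts @ [Node u us]))"
      using *(1) by (rule subtrees_trans) simp
    ultimately show ?thesis using *(2,3) unfolding all by metis
  qed
qed simp

theorem theorem6:
  fixes T :: "'a otree" and v1 v2 :: 'a
  assumes "ordered_tree T"
    and "v1 \<in> vertices T - {tree_root T}"
    and "v2 \<in> vertices T - {tree_root T}"
    and "preorder_less T v1 v2"
  shows "pda T v1 v2 =
    preorder_Max T {x. preorder_le T v1 x \<and> preorder_le T x v2 \<and>
                       depth T x = depth_between T v1 v2}"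
proof -
  let ?ancestor = "\<lambda>v. v \<in> vertices T - {tree_root T} \<and>
    v1 \<in> subtree_verts (dual_tree T) v \<and> v2 \<in> subtree_verts T v"
  note T = assms(1)
  have primal: "subtree_verts T v = vertices (Node v vs)"
    if "Node w (as @ Node v vs # bs) \<in> subtrees T" for w as v vs bs
    using subtree_verts_eq[OF T branch_subtree[OF that]] by simp
  obtain r ts where Tr: "T = Node r ts" by (cases T)
  obtain i j where ij: "i < j" "j < length (preorder T)" "preorder T ! i = v1" "preorder T ! j = v2"
    using assms(4) unfolding preorder_less_def by blast
  \<comment> \<open>Position 0 holds the root. Subtracting one from both positions therefore gives
    indices into the forest \<open>ts\<close>.\<close>
  moreover have "i \<noteq> 0" using ij(3) assms(2) Tr by (metis DiffD2 otree.sel(1) nth_Cons_0 preorder.simps singletonI)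
  ultimately have "i - 1 < j - 1" "j - 1 < length (concat (map preorder ts))"
    "concat (map preorder ts) ! (i - 1) = v1" "concat (map preorder ts) ! (j - 1) = v2"
    using Tr by (auto simp: nth_Cons')
  then obtain w as v vs bs where v: "Node w (as @ Node v vs # bs) \<in> subtrees T"
    "v1 \<in> insert v (\<Union>s\<in>set as. vertices s)" "v2 \<in> vertices (Node v vs)"
    using primal_dual_split[of "i - 1" "j - 1" ts r] Tr by metis
  have "v \<noteq> tree_root T" using branch_not_root[OF T v(1)] by simp
  moreover have "Node v vs \<in> subtrees T" by (rule branch_subtree[OF v(1)]) simp
  then have "v \<in> vertices T" using vertices_subtree by fastforce
  ultimately have ex: "?ancestor v" using v dual_subtree_verts[OF T v(1)] primal[OF v(1)] by simp
  \<comment> \<open>Every vertex with the defining property of the ancestor equals the same maximum.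
    This yields both the uniqueness behind \<open>pda\<close> and the claimed formula.\<close>
  have eq: "u = preorder_Max T {x. preorder_le T v1 x \<and> preorder_le T x v2 \<and>
      depth T x = depth_between T v1 v2}" if u: "?ancestor u" for u
  proof -
    obtain w as us bs where us: "Node w (as @ Node u us # bs) \<in> subtrees T"
      using vertex_is_branch[of u T] u by blast
    show ?thesis
      using last_shallowest_between[OF T us] u dual_subtree_verts[OF T us] primal[OF us] by simp
  qed
  have "pda T v1 v2 = v"
    unfolding pda_def
  proof (rule the_equality)
    show "?ancestor v" by (rule ex)
    show "u = v" if "?ancestor u" for u using eq[OF that] eq[OF ex] by simp
  qed
  then show ?thesis using eq[OF ex] by simp
qed

end
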